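(* Let $\alpha\in\mathbb{R}$, $\alpha\neq0$. There are no $K^\alpha$-translators (for any speed vector $\vec{v}$), other than planes and surfaces of constant Gauss curvature (in particular, other than cylindrical and developable surfaces), that are ruled surfaces.
   Context: Let $\alpha\in\mathbb{R}$, $\alpha\ne 0$, and let $\vec{v}\in\mathbb{R}^3$ be a unit vector. A smooth surface $\Sigma$ in Euclidean space $\mathbb{R}^3$ with unit normal $N$ and Gauss curvature $K$ is called a $K^\alpha$-translator with speed $\vec{v}$ if $K^\alpha=\langle N,\vec{v}\rangle$ on $\Sigma$. The surface is not required to have $K>0$; it is implicitly assumed that $K^\alpha$ makes sense, and $K$ is allowed to be negative when $\alpha\in\mathbb{Z}$ (so for non-flat ruled surfaces, which have $K<0$, $\alpha$ is an integer). Planes and surfaces of constant Gauss curvature (in particular with $K=0$) are discarded throughout. A ruled surface is a surface parametrized by $X(s,t)=\gamma(s)+t\,w(s)$, $s\in I\subset\mathbb{R}$, $t\in\mathbb{R}$, where $\gamma$ is a smooth curve and $w$ is a smooth function with $|w(s)|=1$ for all $s\in I$. It is cylindrical if $w$ is constant. *)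

theory Defs
  imports "HOL-Analysis.Analysis"
begin

text \<open>Derivatives are taken with respect to the ambient space, so these notions are
  meant for open \<open>S\<close>.\<close>

primrec C_k_on :: "nat \<Rightarrow> ('a::real_normed_vector \<Rightarrow> 'b::real_normed_vector) \<Rightarrow> 'a set \<Rightarrow> bool" where
  "C_k_on 0 f S \<longleftrightarrow> continuous_on S f"
| "C_k_on (Suc k) f S \<longleftrightarrow> (\<forall>x\<in>S. f differentiable (at x)) \<and>
     (\<forall>h. C_k_on k (\<lambda>x. frechet_derivative f (at x) h) S)"

definition smooth_on :: "('a::real_normed_vector \<Rightarrow> 'b::real_normed_vector) \<Rightarrow> 'a set \<Rightarrow> bool" where
  "smooth_on f S \<longleftrightarrow> (\<forall>k. C_k_on k f S)"

definition D1 :: "(real \<times> real \<Rightarrow> real ^ 3) \<Rightarrow> real \<times> real \<Rightarrow> real ^ 3" where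
  "D1 X p = frechet_derivative X (at p) (1, 0)"

definition D2 :: "(real \<times> real \<Rightarrow> real ^ 3) \<Rightarrow> real \<times> real \<Rightarrow> real ^ 3" where
  "D2 X p = frechet_derivative X (at p) (0, 1)"

text \<open>An immersed surface \<open>X : U \<rightarrow> \<real>\<^sup>3\<close> together with a choice \<open>N\<close> of unit normal along it;
  either orientation is allowed, and \<open>X\<close> need not be injective.\<close>

definition oriented_surface ::
  "(real \<times> real \<Rightarrow> real ^ 3) \<Rightarrow> (real \<times> real \<Rightarrow> real ^ 3) \<Rightarrow> (real \<times> real) set \<Rightarrow> bool" where
  "oriented_surface X N U \<longleftrightarrow>
     open U \<and> smooth_on X U \<and> (\<forall>p\<in>U. inj (frechet_derivative X (at p))) \<and>
     continuous_on U N \<and>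
     (\<forall>p\<in>U. norm (N p) = 1 \<and> N p \<bullet> D1 X p = 0 \<and> N p \<bullet> D2 X p = 0)"

text \<open>The quotient of the determinants of the second and first fundamental forms.\<close>

definition gauss_curvature ::
  "(real \<times> real \<Rightarrow> real ^ 3) \<Rightarrow> (real \<times> real \<Rightarrow> real ^ 3) \<Rightarrow> real \<times> real \<Rightarrow> real" where
  "gauss_curvature X N p =
     ((D1 (D1 X) p \<bullet> N p) * (D2 (D2 X) p \<bullet> N p) - (D1 (D2 X) p \<bullet> N p)\<^sup>2) /
     ((D1 X p \<bullet> D1 X p) * (D2 X p \<bullet> D2 X p) - (D1 X p \<bullet> D2 X p)\<^sup>2)"

text \<open>Powers \<open>x\<^sup>\<alpha>\<close> with real exponent. A negative base is admitted only for integer exponents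
  (where \<open>powr\<close> does not give the usual value), and the base \<open>0\<close> only for positive ones.\<close>

definition real_power_defined :: "real \<Rightarrow> real \<Rightarrow> bool" where
  "real_power_defined x \<alpha> \<longleftrightarrow> x > 0 \<or> (x = 0 \<and> \<alpha> > 0) \<or> (x < 0 \<and> \<alpha> \<in> \<int>)"

definition real_power :: "real \<Rightarrow> real \<Rightarrow> real" where
  "real_power x \<alpha> = (if x \<ge> 0 then x powr \<alpha> else x powi \<lfloor>\<alpha>\<rfloor>)"

definition K_translator ::
  "real \<Rightarrow> real ^ 3 \<Rightarrow> (real \<times> real \<Rightarrow> real ^ 3) \<Rightarrow> (real \<times> real \<Rightarrow> real ^ 3) \<Rightarrow>
    (real \<times> real) set \<Rightarrow> bool" where
  "K_translator \<alpha> v X N U \<longleftrightarrow> oriented_surface X N U \<and>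
     (\<forall>p\<in>U. real_power_defined (gauss_curvature X N p) \<alpha> \<and>
             real_power (gauss_curvature X N p) \<alpha> = N p \<bullet> v)"

definition ruled_surface :: "(real \<times> real \<Rightarrow> real ^ 3) \<Rightarrow> (real \<times> real) set \<Rightarrow> bool" where
  "ruled_surface X U \<longleftrightarrow>
     (\<exists>I \<gamma> w. is_interval I \<and> open I \<and> smooth_on \<gamma> I \<and> smooth_on w I \<and> (\<forall>s\<in>I. norm (w s) = 1) \<and>
        U = I \<times> UNIV \<and> (\<forall>s\<in>I. \<forall>t. X (s, t) = \<gamma> s + t *\<^sub>R w s))"

definition planar :: "(real \<times> real \<Rightarrow> real ^ 3) \<Rightarrow> (real \<times> real) set \<Rightarrow> bool" where
  "planar X U \<longleftrightarrow> (\<exists>a b. a \<noteq> 0 \<and> (\<forall>p\<in>U. a \<bullet> X p = b))"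

definition constant_gauss_curvature ::
  "(real \<times> real \<Rightarrow> real ^ 3) \<Rightarrow> (real \<times> real \<Rightarrow> real ^ 3) \<Rightarrow> (real \<times> real) set \<Rightarrow> bool" where
  "constant_gauss_curvature X N U \<longleftrightarrow> (\<exists>c. \<forall>p\<in>U. gauss_curvature X N p = c)"

end

theory Submission
  imports Defs "HOL-Analysis.Cross3"
begin

notation cross3 (infixr "\<times>\<^sub>3" 80)

text \<open>The translator equation already fails along a single complete ruling of negative
  curvature. Fix a parameter \<open>s\<close> and write \<open>\<gamma>'\<close>, \<open>w'\<close> for the derivatives there. Along the
  ruling the normal direction \<open>X\<^sub>s \<times>\<^sub>3 X\<^sub>t = p + t q\<close>, where \<open>p = \<gamma>' \<times>\<^sub>3 w\<close> and \<open>q = w' \<times>\<^sub>3 w\<close>, is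
  affine in \<open>t\<close>, while \<open>X\<^sub>t\<^sub>t = 0\<close> leaves only the mixed term in the second fundamental form, so that
  \<open>K = - P\<^sup>2 / |p + t q|\<^sup>4\<close> with \<open>P = w' \<bullet> (\<gamma>' \<times>\<^sub>3 w)\<close> independent of \<open>t\<close>
  (\<open>gauss_curvature_ruled\<close>).

  Suppose \<open>K < 0\<close> at one point. Then \<open>P \<noteq> 0\<close>, which forces \<open>q \<noteq> 0\<close>, and \<open>\<alpha>\<close> must be a nonzero
  integer \<open>n\<close>. Squaring the translator equation removes the sign of the normal and gives
  \<open>(K\<^sup>n)\<^sup>2 |p + t q|\<^sup>2 = (v \<bullet> (p + t q))\<^sup>2\<close> for all real \<open>t\<close>. Since the ruling is a whole line,
  \<open>K\<close> tends to \<open>0\<close> along it, and this identity is impossible (\<open>no_translating_ruling\<close>): for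
  \<open>n < 0\<close> the power \<open>K\<^sup>n\<close> is unbounded although \<open>\<langle>N, v\<rangle>\<close> is at most \<open>1\<close>; for \<open>n > 0\<close> the
  affine function \<open>v \<bullet> (p + t q)\<close> has no zero, hence is constant, and then \<open>|p + t q|\<close> is
  constant as well, contradicting \<open>q \<noteq> 0\<close>.

  Hence \<open>K\<close>, which is never positive on a ruled surface, vanishes identically, and the surface
  is one of constant curvature.\<close>

section \<open>The translator equation along a line\<close>

text \<open>Averaging over \<open>\<plusminus>t\<close> removes the mixed term of the quadratic polynomial \<open>|p + t q|\<^sup>2\<close>.\<close>

lemma norm_affine_parallelogram:
  fixes p q :: "'a::real_inner"
  shows "(norm (p + t *\<^sub>R q))\<^sup>2 + (norm (p + (-t) *\<^sub>R q))\<^sup>2 = 2 * (norm p)\<^sup>2 + 2 * t\<^sup>2 * (norm q)\<^sup>2"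
  unfolding power2_norm_eq_inner
  by (simp add: inner_add_left inner_add_right inner_diff_left inner_diff_right inner_commute
      power2_eq_square algebra_simps)

lemma norm_affine_unbounded:
  fixes p q :: "'a::real_inner"
  assumes "q \<noteq> 0"
  shows "\<exists>t. (norm (p + t *\<^sub>R q))\<^sup>2 > M"
proof (rule ccontr)
  assume "\<not> ?thesis"
  then have le: "(norm (p + t *\<^sub>R q))\<^sup>2 \<le> M" for t
    by (simp add: not_less)
  define t where "t = (\<bar>M\<bar> + 1) / norm q"
  have "t\<^sup>2 * (norm q)\<^sup>2 = (\<bar>M\<bar> + 1)\<^sup>2"
    using assms by (simp add: t_def power_divide)
  moreover have "(\<bar>M\<bar> + 1)\<^sup>2 > M"
    by (rule order.strict_trans2[of _ "\<bar>M\<bar> + 1"]) (auto simp: power2_eq_square algebra_simps)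
  moreover have "(norm p)\<^sup>2 \<ge> 0"
    by simp
  ultimately show False
    using norm_affine_parallelogram[of p t q] le[of t] le[of "-t"] by linarith
qed

lemma affine_nonvanishing_imp_constant:
  fixes a b :: real
  assumes "\<And>t. a + t * b \<noteq> 0"
  shows "b = 0"
proof (rule ccontr)
  assume "b \<noteq> 0"
  then have "a + (- a / b) * b = 0"
    by simp
  with assms show False
    by blast
qed

text \<open>Here \<open>p + t q\<close> is the unnormalised normal of the surface along the ruling and
  \<open>- P\<^sup>2 / |p + t q|\<^sup>4\<close> its Gauss curvature. Squaring
  \<open>K\<^sup>n = \<langle>N, v\<rangle>\<close> turns it into an identity between rational functions of \<open>t\<close>.\<close>

lemma no_translating_ruling:
  fixes p q v :: "'a::real_inner" and P :: real and n :: int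
  assumes "n \<noteq> 0" "P \<noteq> 0" "q \<noteq> 0" "norm v = 1"
    and nz: "\<And>t. p + t *\<^sub>R q \<noteq> 0"
    and eq: "\<And>t. ((- P\<^sup>2 / (norm (p + t *\<^sub>R q)) ^ 4) powi n)\<^sup>2 * (norm (p + t *\<^sub>R q))\<^sup>2
                 = (v \<bullet> (p + t *\<^sub>R q))\<^sup>2"
  shows False
proof -
  define Q where "Q t = (norm (p + t *\<^sub>R q))\<^sup>2" for t
  have Q_pos: "Q t > 0" for t
    using nz by (simp add: Q_def)
  have norm4: "(norm (p + t *\<^sub>R q)) ^ 4 = (Q t)\<^sup>2" for t
    by (simp add: Q_def flip: power_mult)
  show False
  proof (cases "n > 0")
    case True
    define m where "m = nat n"
    have m: "m > 0" and n: "n = int m"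
      using True by (auto simp: m_def)
    obtain k where k: "4 * m = Suc k" "k > 0"
      using m by (cases "4 * m") auto
    have P_power: "P ^ (4 * m) = (v \<bullet> (p + t *\<^sub>R q))\<^sup>2 * Q t ^ k" for t
    proof -
      have "((- P\<^sup>2 / (Q t)\<^sup>2) ^ m)\<^sup>2 = P ^ (4 * m) / Q t ^ (4 * m)"
        by (simp add: power_divide mult.commute flip: power_mult)
      then have "P ^ (4 * m) / Q t ^ (4 * m) * Q t = (v \<bullet> (p + t *\<^sub>R q))\<^sup>2"
        using eq[of t] by (simp add: norm4 n flip: Q_def)
      moreover have "Q t ^ (4 * m) = Q t * Q t ^ k"
        by (simp add: k)
      ultimately show ?thesis
        using Q_pos[of t] by (simp add: divide_simps)
    qed
    have "v \<bullet> p + t * (v \<bullet> q) \<noteq> 0" for t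
      using P_power[of t] \<open>P \<noteq> 0\<close> by (auto simp: inner_add_right)
    from affine_nonvanishing_imp_constant[OF this] have "v \<bullet> q = 0" .
    then have "(v \<bullet> p)\<^sup>2 * Q t ^ k = (v \<bullet> p)\<^sup>2 * Q 0 ^ k" "v \<bullet> p \<noteq> 0" for t
      using P_power[of t] P_power[of 0] \<open>P \<noteq> 0\<close> by (auto simp: inner_add_right)
    then have "Q t ^ k = Q 0 ^ k" for t
      by simp
    then have "Q t = Q 0" for t
      using power_eq_imp_eq_base[OF _ _ _ \<open>k > 0\<close>] Q_pos less_imp_le by blast
    from this[of 1] this[of "-1"] have "(norm q)\<^sup>2 = 0"
      using norm_affine_parallelogram[of p 1 q] by (simp add: Q_def)
    with \<open>q \<noteq> 0\<close> show False
      by simp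
  next
    case False
    define m where "m = nat (- n)"
    have m: "m > 0" and n: "n = - int m"
      using False \<open>n \<noteq> 0\<close> by (auto simp: m_def)
    \<comment> \<open>Far out on the ruling \<open>|K| < 1\<close>, so \<open>|K\<^sup>n| > 1\<close>, against Cauchy--Schwarz.\<close>
    obtain t where t: "Q t > \<bar>P\<bar>"
      using norm_affine_unbounded[OF \<open>q \<noteq> 0\<close>] unfolding Q_def by blast
    have "1 < Q t / \<bar>P\<bar>"
      using t \<open>P \<noteq> 0\<close> by simp
    then have "1 < (Q t / \<bar>P\<bar>) ^ (4 * m)"
      using m by (intro one_less_power) auto
    moreover have "((- P\<^sup>2 / (Q t)\<^sup>2) powi n)\<^sup>2 = (Q t / \<bar>P\<bar>) ^ (4 * m)"
      by (simp add: n power_int_minus power_divide mult.commute power_even_abs field_simps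
          flip: power_mult)
    ultimately have "1 * Q t < ((- P\<^sup>2 / (Q t)\<^sup>2) powi n)\<^sup>2 * Q t"
      by (intro mult_strict_right_mono Q_pos) simp
    then have "Q t < (v \<bullet> (p + t *\<^sub>R q))\<^sup>2"
      using eq[of t] by (simp add: norm4 flip: Q_def)
    also have "\<dots> \<le> (norm v * norm (p + t *\<^sub>R q))\<^sup>2"
      by (rule abs_le_square_iff[THEN iffD1]) (simp add: Cauchy_Schwarz_ineq2)
    finally show False
      using \<open>norm v = 1\<close> by (simp add: Q_def)
  qed
qed

section \<open>The geometry of a ruled parametrization\<close>

lemma smooth_on_imp_has_vector_derivative:
  assumes "smooth_on f S" "s \<in> S"
  shows "(f has_vector_derivative vector_derivative f (at s)) (at s)"
proof -
  have "C_k_on (Suc 0) f S"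
    using assms(1) by (simp add: smooth_on_def)
  then show ?thesis
    using assms(2) by (simp add: vector_derivative_works[symmetric])
qed

lemma has_derivative_compose_fst:
  assumes "(f has_vector_derivative f') (at (fst p))"
  shows "((\<lambda>p. f (fst p)) has_derivative (\<lambda>h. fst h *\<^sub>R f')) (at p)"
  using has_derivative_compose[of fst fst p UNIV f "\<lambda>x. x *\<^sub>R f'"] assms
  by (simp add: has_vector_derivative_def bounded_linear_fst bounded_linear_imp_has_derivative)

text \<open>The square hides the orientation: \<open>a \<times>\<^sub>3 b\<close> is \<open>\<plusminus>|a \<times>\<^sub>3 b|\<close> times any unit normal to \<open>a\<close>
  and \<open>b\<close>, because its cross product with that normal vanishes.\<close>

lemma inner_cross3_power2_unit_normal:
  fixes a b N u :: "real ^ 3"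
  assumes "norm N = 1" "N \<bullet> a = 0" "N \<bullet> b = 0"
  shows "(u \<bullet> (a \<times>\<^sub>3 b))\<^sup>2 = (norm (a \<times>\<^sub>3 b))\<^sup>2 * (u \<bullet> N)\<^sup>2"
proof -
  define c where "c = a \<times>\<^sub>3 b"
  have Nc: "N \<times>\<^sub>3 c = 0"
    using assms Lagrange[of N a b] by (simp add: c_def)
  have "N \<times>\<^sub>3 (N \<times>\<^sub>3 c) = (N \<bullet> c) *\<^sub>R N - c"
    using Lagrange[of N N c] \<open>norm N = 1\<close> by (simp add: norm_eq_1)
  then have c: "c = (N \<bullet> c) *\<^sub>R N"
    using Nc by simp
  have "norm c = \<bar>N \<bullet> c\<bar>"
    using arg_cong[OF c, of norm] \<open>norm N = 1\<close> by simp
  moreover have "u \<bullet> c = (N \<bullet> c) * (u \<bullet> N)"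
    using arg_cong[OF c, of "\<lambda>x. u \<bullet> x"] by simp
  ultimately show ?thesis
    by (simp add: power_mult_distrib flip: c_def)
qed

context
  fixes X :: "real \<times> real \<Rightarrow> real ^ 3" and \<gamma> w :: "real \<Rightarrow> real ^ 3" and I :: "real set"
  assumes I: "open I" and \<gamma>: "smooth_on \<gamma> I" and w: "smooth_on w I"
    and X: "\<And>s t. s \<in> I \<Longrightarrow> X (s, t) = \<gamma> s + t *\<^sub>R w s"
begin

lemma ruled_has_derivative:
  assumes "s \<in> I"
  shows "(X has_derivative (\<lambda>h. fst h *\<^sub>R vector_derivative \<gamma> (at s) +
      (t *\<^sub>R fst h *\<^sub>R vector_derivative w (at s) + snd h *\<^sub>R w s))) (at (s, t))"
proof (rule has_derivative_transform_within_open)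
  have \<gamma>': "((\<lambda>p. \<gamma> (fst p)) has_derivative (\<lambda>h. fst h *\<^sub>R vector_derivative \<gamma> (at s))) (at (s, t))"
    by (rule has_derivative_compose_fst)
      (use \<gamma> assms in \<open>auto intro: smooth_on_imp_has_vector_derivative\<close>)
  have w': "((\<lambda>p. w (fst p)) has_derivative (\<lambda>h. fst h *\<^sub>R vector_derivative w (at s))) (at (s, t))"
    by (rule has_derivative_compose_fst)
      (use w assms in \<open>auto intro: smooth_on_imp_has_vector_derivative\<close>)
  have "(snd has_derivative snd) (at (s, t))"
    by (rule bounded_linear_imp_has_derivative[OF bounded_linear_snd])
  from has_derivative_add[OF \<gamma>' has_derivative_scaleR[OF this w']]
  show "((\<lambda>p. \<gamma> (fst p) + snd p *\<^sub>R w (fst p)) has_derivative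
      (\<lambda>h. fst h *\<^sub>R vector_derivative \<gamma> (at s) +
      (t *\<^sub>R fst h *\<^sub>R vector_derivative w (at s) + snd h *\<^sub>R w s))) (at (s, t))"
    by simp
  show "open (I \<times> (UNIV :: real set))"
    using I by (simp add: open_Times)
qed (use assms X in auto)

lemma D1_ruled:
  assumes "s \<in> I"
  shows "D1 X (s, t) = vector_derivative \<gamma> (at s) + t *\<^sub>R vector_derivative w (at s)"
  by (simp add: D1_def frechet_derivative_at[OF ruled_has_derivative[OF assms], symmetric])

lemma D2_ruled:
  assumes "s \<in> I"
  shows "D2 X (s, t) = w s"
  by (simp add: D2_def frechet_derivative_at[OF ruled_has_derivative[OF assms], symmetric])

lemma D2_ruled_has_derivative:
  assumes "s \<in> I"
  shows "(D2 X has_derivative (\<lambda>h. fst h *\<^sub>R vector_derivative w (at s))) (at (s, t))"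
proof (rule has_derivative_transform_within_open)
  show "((\<lambda>p. w (fst p)) has_derivative (\<lambda>h. fst h *\<^sub>R vector_derivative w (at s))) (at (s, t))"
    by (rule has_derivative_compose_fst)
      (use w assms in \<open>auto intro: smooth_on_imp_has_vector_derivative\<close>)
  show "open (I \<times> (UNIV :: real set))"
    using I by (simp add: open_Times)
qed (use assms D2_ruled in auto)

lemma D1_D2_ruled:
  assumes "s \<in> I"
  shows "D1 (D2 X) (s, t) = vector_derivative w (at s)"
  by (simp add: D1_def[of "D2 X"]
      frechet_derivative_at[OF D2_ruled_has_derivative[OF assms], symmetric])

lemma D2_D2_ruled:
  assumes "s \<in> I"
  shows "D2 (D2 X) (s, t) = 0"
  by (simp add: D2_def[of "D2 X"]
      frechet_derivative_at[OF D2_ruled_has_derivative[OF assms], symmetric])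

text \<open>The mixed coefficient \<open>X\<^sub>s\<^sub>t \<bullet> N\<close> is a triple product in which the term \<open>t w'\<close> of \<open>X\<^sub>s\<close>
  cancels, which is why the numerator does not depend on \<open>t\<close>. At a point where \<open>X\<close> fails to be an
  immersion both sides are \<open>0\<close>, by division by zero.\<close>

lemma gauss_curvature_ruled:
  assumes s: "s \<in> I"
    and N: "norm (N (s, t)) = 1" "N (s, t) \<bullet> D1 X (s, t) = 0" "N (s, t) \<bullet> D2 X (s, t) = 0"
  defines "\<gamma>' \<equiv> vector_derivative \<gamma> (at s)" and "w' \<equiv> vector_derivative w (at s)"
  shows "gauss_curvature X N (s, t) =
    - (w' \<bullet> (\<gamma>' \<times>\<^sub>3 w s))\<^sup>2 / (norm (\<gamma>' \<times>\<^sub>3 w s + t *\<^sub>R (w' \<times>\<^sub>3 w s))) ^ 4"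
proof -
  define c where "c = \<gamma>' \<times>\<^sub>3 w s + t *\<^sub>R (w' \<times>\<^sub>3 w s)"
  have c: "D1 X (s, t) \<times>\<^sub>3 D2 X (s, t) = c"
    by (simp add: D1_ruled[OF s] D2_ruled[OF s] \<gamma>'_def w'_def c_def cross_add_left cross_mult_left)
  have P: "w' \<bullet> (\<gamma>' \<times>\<^sub>3 w s) = w' \<bullet> c"
    by (simp add: c_def inner_add_right dot_cross_self)
  have "(w' \<bullet> c)\<^sup>2 = (norm c)\<^sup>2 * (w' \<bullet> N (s, t))\<^sup>2"
    using inner_cross3_power2_unit_normal[OF N] by (simp add: c)
  moreover have "(D1 X (s, t) \<bullet> D1 X (s, t)) * (D2 X (s, t) \<bullet> D2 X (s, t))
      - (D1 X (s, t) \<bullet> D2 X (s, t))\<^sup>2 = (norm c)\<^sup>2"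
    using norm_cross_dot[of "D1 X (s, t)" "D2 X (s, t)"]
    by (simp add: c power_mult_distrib flip: power2_norm_eq_inner)
  moreover have "(norm c)\<^sup>2 * x / (norm c) ^ 4 = x / (norm c)\<^sup>2" for x
    by (cases "c = 0") (auto simp: divide_simps simp flip: power_add)
  ultimately show ?thesis
    unfolding gauss_curvature_def P
    by (simp add: D1_D2_ruled[OF s] D2_D2_ruled[OF s] flip: w'_def c_def)
qed

lemma ruled_translator_flat:
  assumes "\<alpha> \<noteq> 0" "norm v = 1" and tr: "K_translator \<alpha> v X N (I \<times> UNIV)" and s: "s \<in> I"
  shows "gauss_curvature X N (s, t) = 0"
proof (rule ccontr)
  assume K_nz: "gauss_curvature X N (s, t) \<noteq> 0"
  define \<gamma>' w' where "\<gamma>' = vector_derivative \<gamma> (at s)" and "w' = vector_derivative w (at s)"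
  define p q P where "p = \<gamma>' \<times>\<^sub>3 w s" and "q = w' \<times>\<^sub>3 w s" and "P = w' \<bullet> (\<gamma>' \<times>\<^sub>3 w s)"
  have N: "norm (N (s, t)) = 1" "N (s, t) \<bullet> D1 X (s, t) = 0" "N (s, t) \<bullet> D2 X (s, t) = 0" for t
    using tr s by (auto simp: K_translator_def oriented_surface_def)
  have K: "gauss_curvature X N (s, t) = - P\<^sup>2 / (norm (p + t *\<^sub>R q)) ^ 4" for t
    using gauss_curvature_ruled[of s N t, OF s N] by (simp add: P_def p_def q_def \<gamma>'_def w'_def)
  have "P \<noteq> 0"
    using K_nz K by auto
  have P: "P = w' \<bullet> (p + t *\<^sub>R q)" for t
    by (simp add: P_def p_def q_def inner_add_right dot_cross_self)
  have nz: "p + t *\<^sub>R q \<noteq> 0" for t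
    using P[of t] \<open>P \<noteq> 0\<close> by auto
  have "q \<noteq> 0"
  proof
    \<comment> \<open>\<open>P\<close> is also \<open>\<gamma>' \<bullet> (w \<times>\<^sub>3 w')\<close>.\<close>
    assume "q = 0"
    then have "w s \<times>\<^sub>3 w' = 0"
      using cross_skew[of "w s" w'] by (simp add: q_def)
    then show False
      using cross_triple[of \<gamma>' "w s" w'] \<open>P \<noteq> 0\<close>
      by (metis P_def cross_triple inner_commute inner_zero_left)
  qed
  have neg: "gauss_curvature X N (s, t) < 0" for t
    using \<open>P \<noteq> 0\<close> nz by (simp add: K)
  have "real_power_defined (gauss_curvature X N (s, 0)) \<alpha>"
    using tr s by (auto simp: K_translator_def)
  then have "\<alpha> \<in> \<int>"
    using neg[of 0] by (auto simp: real_power_defined_def)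
  then have "\<lfloor>\<alpha>\<rfloor> \<noteq> 0"
    using \<open>\<alpha> \<noteq> 0\<close> by (auto elim: Ints_cases)
  moreover have "((- P\<^sup>2 / (norm (p + t *\<^sub>R q)) ^ 4) powi \<lfloor>\<alpha>\<rfloor>)\<^sup>2 * (norm (p + t *\<^sub>R q))\<^sup>2
      = (v \<bullet> (p + t *\<^sub>R q))\<^sup>2" for t
  proof -
    have "real_power (gauss_curvature X N (s, t)) \<alpha> = N (s, t) \<bullet> v"
      using tr s by (auto simp: K_translator_def)
    then have "gauss_curvature X N (s, t) powi \<lfloor>\<alpha>\<rfloor> = v \<bullet> N (s, t)"
      using neg[of t] by (simp add: real_power_def inner_commute)
    moreover have "D1 X (s, t) \<times>\<^sub>3 D2 X (s, t) = p + t *\<^sub>R q"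
      by (simp add: D1_ruled[OF s] D2_ruled[OF s] \<gamma>'_def w'_def p_def q_def cross_add_left
          cross_mult_left)
    ultimately show ?thesis
      using inner_cross3_power2_unit_normal[OF N, of v t] unfolding K
      by (simp add: mult.commute)
  qed
  ultimately show False
    using no_translating_ruling[of "\<lfloor>\<alpha>\<rfloor>" P q v p] \<open>P \<noteq> 0\<close> \<open>q \<noteq> 0\<close> \<open>norm v = 1\<close> nz by blast
qed

end

section \<open>Ruled translators\<close>

theorem theorem5p1:
  fixes \<alpha> :: real and v :: "real ^ 3"
  assumes "\<alpha> \<noteq> 0" and "norm v = 1"
  shows "\<not> (\<exists>X N U. K_translator \<alpha> v X N U \<and> ruled_surface X U \<and>
                 \<not> planar X U \<and> \<not> constant_gauss_curvature X N U)"
proof -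
  have "constant_gauss_curvature X N U" if tr: "K_translator \<alpha> v X N U" and "ruled_surface X U"
    for X N U
  proof -
    obtain I \<gamma> w where "open I" "smooth_on \<gamma> I" "smooth_on w I" and U: "U = I \<times> UNIV"
      and X: "\<And>s t. s \<in> I \<Longrightarrow> X (s, t) = \<gamma> s + t *\<^sub>R w s"
      using \<open>ruled_surface X U\<close> unfolding ruled_surface_def by blast
    then have "gauss_curvature X N (s, t) = 0" if "s \<in> I" for s t
      using ruled_translator_flat[of I \<gamma> w X \<alpha> v N s t] assms tr that by simp
    then show ?thesis
      unfolding constant_gauss_curvature_def U by (intro exI[of _ 0]) auto
  qed
  then show ?thesis
    by blast
qed

end
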